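(* Let $\mathcal{X}$ be a first-countable Hausdorff space and let $G$ be a group of homeomorphisms of $\mathcal{X}$. Assume that the action of $G$ on $\mathcal{X}$ is minimal and that for every open set $U\subseteq \mathcal{X}$, the action of $\mathrm{Rist}_G(U)$ on $U$ is locally minimal. Then, for all $x,y\in \mathcal{X}$, there exists a homeomorphism $f\colon \mathcal{X}\rightarrow \mathcal{X}$ in the Ellis semigroup of $G$ such that $f\,\mathrm{St}_G^{0}(x)\,f^{-1}=\mathrm{St}_G^{0}(y)$. In particular, $\mathrm{St}_G^{0}(x)$ and $\mathrm{St}_G^{0}(y)$ are isomorphic.
   Context: "Neighbourhood" always means open neighbourhood. Let $G$ be a group of homeomorphisms of a topological space $\mathcal{X}$. - $\mathrm{St}_G(x)=\{g\in G\mid g(x)=x\}$. The neighbourhood stabiliser $\mathrm{St}_G^0(x)$ is the subgroup of all $g\in \mathrm{St}_G(x)$ whose set of fixed points contains a neighbourhood of $x$. - For an open set $U\subseteq\mathcal{X}$, the rigid stabiliser is $\mathrm{Rist}_G(U)=\{g\in G\mid g(x)=x \text{ for all } x\in\mathcal{X}\setminus U\}$. - An action of a group on a space is minimal if the orbit of every point is dense. The action of a group $H$ on a space $Y$ is locally minimal if for every $x\in Y$ there exists a neighbourhood $W\subseteq Y$ of $x$ such that for every $y\in W$, the intersection of the $H$-orbit of $y$ with $W$ is dense in $W$. - The Ellis semigroup of $G$ is the closure of the image of $G$ in the set $\mathcal{X}^{\mathcal{X}}$ of all maps from $\mathcal{X}$ to $\mathcal{X}$, with the topology of pointwise convergence.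 *)

theory Defs
  imports "HOL-Analysis.Analysis" "HOL-Algebra.Group"
begin

definition homeo_group :: "('a::topological_space \<Rightarrow> 'a) monoid" where
  "homeo_group = \<lparr>carrier = {f. \<exists>g. homeomorphism UNIV UNIV f g}, mult = (\<circ>), one = id\<rparr>"

lemma group_homeo_group: "group homeo_group"
proof (rule groupI)
  fix f :: "'a \<Rightarrow> 'a" assume "f \<in> carrier homeo_group"
  then obtain g where g: "homeomorphism UNIV UNIV f g"
    by (auto simp: homeo_group_def)
  then have "homeomorphism UNIV UNIV g f" "g \<circ> f = id"
    by (auto simp: homeomorphism_symD homeomorphism_def fun_eq_iff)
  then show "\<exists>h\<in>carrier homeo_group. h \<otimes>\<^bsub>homeo_group\<^esub> f = \<one>\<^bsub>homeo_group\<^esub>"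
    by (auto simp: homeo_group_def)
next
  have "homeomorphism UNIV UNIV (id :: 'a \<Rightarrow> 'a) id"
    by (simp add: homeomorphism_def)
  then show "\<one>\<^bsub>homeo_group\<^esub> \<in> carrier (homeo_group :: ('a \<Rightarrow> 'a) monoid)"
    by (auto simp: homeo_group_def)
qed (auto simp: homeo_group_def o_assoc intro: homeomorphism_compose)

text \<open>Below, a group of homeomorphisms \<open>G\<close> is represented by its underlying set, to be used
  with the assumption \<^term>\<open>subgroup G homeo_group\<close>.\<close>

definition point_orbit :: "('a \<Rightarrow> 'a) set \<Rightarrow> 'a \<Rightarrow> 'a set" where
  "point_orbit G x = {g x | g. g \<in> G}"

definition St :: "('a \<Rightarrow> 'a) set \<Rightarrow> 'a \<Rightarrow> ('a \<Rightarrow> 'a) set" where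
  "St G x = {g \<in> G. g x = x}"

definition St0 :: "('a::topological_space \<Rightarrow> 'a) set \<Rightarrow> 'a \<Rightarrow> ('a \<Rightarrow> 'a) set" where
  "St0 G x = {g \<in> St G x. \<exists>W. open W \<and> x \<in> W \<and> W \<subseteq> {z. g z = z}}"

definition Rist :: "('a \<Rightarrow> 'a) set \<Rightarrow> 'a set \<Rightarrow> ('a \<Rightarrow> 'a) set" where
  "Rist G U = {g \<in> G. \<forall>x\<in>- U. g x = x}"

definition minimal_action :: "('a::topological_space \<Rightarrow> 'a) set \<Rightarrow> bool" where
  "minimal_action G \<longleftrightarrow> (\<forall>x. closure (point_orbit G x) = UNIV)"

text \<open>For \<open>W \<subseteq> Y\<close>, density of a subset \<open>A\<close> of \<open>W\<close> in the subspace \<open>W\<close> means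
  \<open>W \<subseteq> closure A\<close> with the closure taken in the ambient space. The definition is meant for
  \<open>H\<close> mapping \<open>Y\<close> to itself, as \<^term>\<open>Rist G U\<close> does with \<open>U\<close>.\<close>

definition locally_minimal_on :: "('a::topological_space \<Rightarrow> 'a) set \<Rightarrow> 'a set \<Rightarrow> bool" where
  "locally_minimal_on H Y \<longleftrightarrow>
     (\<forall>x\<in>Y. \<exists>W. openin (top_of_set Y) W \<and> x \<in> W \<and>
        (\<forall>y\<in>W. W \<subseteq> closure (point_orbit H y \<inter> W)))"

text \<open>The topology on the function type is the product topology, that is, the topology of
  pointwise convergence.\<close>

definition ellis_semigroup :: "('a::topological_space \<Rightarrow> 'a) set \<Rightarrow> ('a \<Rightarrow> 'a) set" where
  "ellis_semigroup G = closure G"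

end

theory Submission imports Defs begin

unbundle no m_inv_syntax

text \<open>The conjugating map is a pointwise limit of elements \<open>g n\<close> of \<open>G\<close>. One builds decreasing
  neighbourhood bases \<open>U n\<close> of \<open>x\<close> and \<open>g n ` U n\<close> of \<open>y\<close> such that \<open>g (Suc n)\<close> agrees with \<open>g n\<close>
  off \<open>U n\<close>. The limit \<open>f\<close> is then a homeomorphism mapping \<open>x\<close> to \<open>y\<close>, and if \<open>h\<close> is trivial on \<open>U n\<close>,
  then conjugating \<open>h\<close> by \<open>f\<close> or by \<open>g n\<close> gives the same element of \<open>G\<close>. In the inductive
  step, local minimality of the rigid stabiliser of \<open>U n\<close> is used to move \<open>x\<close> so that its image
  comes close to \<open>y\<close>, and local minimality of the rigid stabiliser of a small neighbourhood of \<open>y\<close>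
  is used to move the image of an even smaller neighbourhood of \<open>x\<close> over \<open>y\<close>.\<close>

section \<open>Groups of homeomorphisms and rigid stabilisers\<close>

lemma homeo_group_inv:
  assumes "f \<in> carrier homeo_group"
  shows "homeomorphism UNIV UNIV f (inv f)"
proof -
  from assms obtain g where g: "homeomorphism UNIV UNIV f g"
    by (auto simp: homeo_group_def)
  then have "inv f = g"
    by (intro inv_unique_comp) (auto simp: homeomorphism_def fun_eq_iff)
  with g show ?thesis by simp
qed

locale homeo_subgroup =
  fixes G :: "('a::topological_space \<Rightarrow> 'a) set"
  assumes subgroup: "subgroup G homeo_group"
begin

lemma homeomorphism_inv: "g \<in> G \<Longrightarrow> homeomorphism UNIV UNIV g (inv g)"
  using subgroup.subset[OF subgroup] by (blast intro: homeo_group_inv)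

lemma comp_mem: "g \<in> G \<Longrightarrow> h \<in> G \<Longrightarrow> g \<circ> h \<in> G"
  using subgroup.m_closed[OF subgroup] by (simp add: homeo_group_def)

lemma bij_mem: "g \<in> G \<Longrightarrow> bij g"
  using homeomorphism_inv by (metis bijI homeomorphism_def inj_on_inverseI UNIV_I)

text \<open>Closure under inverses is known for the group inverse of \<open>homeo_group\<close>,
  which has to be identified with the inverse function, denoted by \<open>inv\<close> here.\<close>

lemma inv_mem:
  assumes "g \<in> G"
  shows "inv g \<in> G"
proof -
  have carr: "g \<in> carrier homeo_group" "inv g \<in> carrier homeo_group"
    using homeomorphism_inv[OF assms] by (auto simp: homeo_group_def dest: homeomorphism_symD)
  have "inv g \<circ> g = id"
    using bij_mem[OF assms] by (simp add: bij_is_inj)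
  then have "m_inv homeo_group g = inv g"
    using carr by (intro group.inv_equality[OF group_homeo_group]) (auto simp: homeo_group_def)
  then show ?thesis
    using subgroup.m_inv_closed[OF subgroup assms] by simp
qed

lemma open_image_mem: "g \<in> G \<Longrightarrow> open S \<Longrightarrow> open (g ` S)"
  using homeomorphism_imp_open_map[OF homeomorphism_inv, of g S] by simp

lemma open_vimage_mem: "g \<in> G \<Longrightarrow> open S \<Longrightarrow> open (g -` S)"
  using homeomorphism_inv[of g] by (simp add: homeomorphism_def open_vimage)

text \<open>A bijection that fixes the complement of \<open>U\<close> pointwise maps that complement
  onto itself.\<close>

lemma Rist_image:
  assumes "r \<in> Rist G U"
  shows "r ` U = U"
proof -
  have r: "bij r" "\<And>z. z \<notin> U \<Longrightarrow> r z = z"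
    using assms bij_mem by (auto simp: Rist_def)
  have "r ` (- U) = - U"
    using r(2) by force
  then show ?thesis
    using bij_image_Compl_eq[OF r(1), of U] by auto
qed

lemma inv_Rist:
  assumes "r \<in> Rist G U"
  shows "inv r \<in> Rist G U"
  using assms inv_mem bij_mem unfolding Rist_def
  by (auto intro: inv_f_eq bij_is_inj)

end

section \<open>Limit of a contracting sequence\<close>

text \<open>Separates the limit argument from the construction: values of \<open>g n\<close> off
  \<open>U n\<close> are final, and all later changes are confined to sets shrinking to
  \<open>x\<close> and, in the image, to \<open>y\<close>.\<close>

locale contracting_sequence = homeo_subgroup G
  for G :: "('a::t2_space \<Rightarrow> 'a) set" +
  fixes g :: "nat \<Rightarrow> 'a \<Rightarrow> 'a" and U :: "nat \<Rightarrow> 'a set" and x y :: 'a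
  assumes g_mem: "g n \<in> G"
    and open_U: "open (U n)"
    and x_mem: "x \<in> U n"
    and y_mem: "y \<in> g n ` U n"
    and U_Suc: "U (Suc n) \<subseteq> U n"
    and gU_Suc: "g (Suc n) ` U (Suc n) \<subseteq> g n ` U n"
    and g_Suc: "z \<notin> U n \<Longrightarrow> g (Suc n) z = g n z"
    and base_x: "open S \<Longrightarrow> x \<in> S \<Longrightarrow> \<exists>n. U n \<subseteq> S"
    and base_y: "open S \<Longrightarrow> y \<in> S \<Longrightarrow> \<exists>n. g n ` U n \<subseteq> S"
begin

lemma U_antimono: "m \<le> n \<Longrightarrow> U n \<subseteq> U m"
  using U_Suc by (rule lift_Suc_antimono_le)

lemma gU_antimono: "m \<le> n \<Longrightarrow> g n ` U n \<subseteq> g m ` U m"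
  using lift_Suc_antimono_le[of "\<lambda>n. g n ` U n"] gU_Suc by blast

lemma g_eq: "m \<le> n \<Longrightarrow> z \<notin> U m \<Longrightarrow> g n z = g m z"
proof (induction n rule: dec_induct)
  case (step n)
  then have "z \<notin> U n" using U_antimono by blast
  with step show ?case by (simp add: g_Suc)
qed simp

lemma bij_g: "bij (g n)"
  using g_mem bij_mem by blast

lemma g_mem_image_iff: "g n z \<in> g n ` U n \<longleftrightarrow> z \<in> U n"
  using bij_g by (simp add: bij_is_inj inj_image_mem_iff)

lemma separate:
  assumes "z \<noteq> x"
  obtains n N where "open N" "z \<in> N" "N \<inter> U n = {}"
proof -
  obtain N S where "open N" "open S" "z \<in> N" "x \<in> S" "N \<inter> S = {}"
    using hausdorff[OF assms] by blast
  moreover from this obtain n where "U n \<subseteq> S" using base_x by blast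
  ultimately show ?thesis using that[of N n] by blast
qed

text \<open>For \<open>z\<close> other than \<open>x\<close>, \<open>LEAST\<close> picks the stage
  at which \<open>z\<close> first lies outside \<open>U n\<close>; from there on its image no longer
  changes.\<close>

definition limit_map :: "'a \<Rightarrow> 'a" where
  "limit_map z = (if z = x then y else g (LEAST n. z \<notin> U n) z)"

lemma limit_map_eq:
  assumes "z \<notin> U n"
  shows "limit_map z = g n z"
proof -
  have "z \<noteq> x" using assms x_mem by blast
  moreover have "g n z = g (LEAST n. z \<notin> U n) z"
    by (rule g_eq) (use assms in \<open>auto intro: Least_le dest: LeastI[of "\<lambda>n. z \<notin> U n"]\<close>)
  ultimately show ?thesis by (simp add: limit_map_def)
qed

lemma limit_map_base: "limit_map x = y"
  by (simp add: limit_map_def)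

text \<open>Otherwise the limit value would be \<open>g n w\<close> with \<open>w\<close> off
  \<open>U n\<close>, hence also \<open>g m w\<close> for all later \<open>m\<close>; some later
  \<open>g m\<close> would then take it at both \<open>w\<close> and \<open>z\<close>, against
  injectivity.\<close>

lemma limit_map_image: "z \<in> U n \<Longrightarrow> limit_map z \<in> g n ` U n"
proof (cases "z = x")
  case False
  assume z: "z \<in> U n"
  obtain m where m: "z \<notin> U m" using separate[OF False] by blast
  show ?thesis
  proof (rule ccontr)
    assume "limit_map z \<notin> g n ` U n"
    then obtain w where w: "limit_map z = g n w" "w \<notin> U n"
      using bij_g[of n] by (metis bij_pointE imageI)
    have "m > n" using m z U_antimono by (meson in_mono not_le)
    then have "g m w = g m z" using w g_eq[of n m w] limit_map_eq[OF m] by simp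
    then show False using w z bij_g[of m] by (metis bij_pointE)
  qed
qed (use y_mem limit_map_base in simp)

text \<open>Near a point other than \<open>x\<close> the limit coincides with some
  \<open>g n\<close>. At \<open>x\<close>, continuity holds because the images of \<open>U n\<close>
  under \<open>g n\<close> shrink to \<open>y\<close>.\<close>

lemma continuous_limit_map: "continuous_on UNIV limit_map"
  unfolding continuous_on_topological
proof (intro ballI allI impI)
  fix z B assume B: "open B" "limit_map z \<in> B"
  show "\<exists>A. open A \<and> z \<in> A \<and> (\<forall>w\<in>UNIV. w \<in> A \<longrightarrow> limit_map w \<in> B)"
  proof (cases "z = x")
    case True
    with B obtain n where "g n ` U n \<subseteq> B" using base_y limit_map_base by metis
    then have "\<forall>w\<in>UNIV. w \<in> U n \<longrightarrow> limit_map w \<in> B" using limit_map_image by blast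
    then show ?thesis using True open_U x_mem by metis
  next
    case False
    then obtain n N where N: "open N" "z \<in> N" "N \<inter> U n = {}" by (rule separate)
    then have "limit_map w = g n w" if "w \<in> N" for w
      using that limit_map_eq by blast
    then have "open (N \<inter> g n -` B) \<and> z \<in> N \<inter> g n -` B \<and>
        (\<forall>w\<in>UNIV. w \<in> N \<inter> g n -` B \<longrightarrow> limit_map w \<in> B)"
      using N B open_vimage_mem[OF g_mem] by auto
    then show ?thesis by blast
  qed
qed

text \<open>Convergence of \<open>g\<close> in the product topology is pointwise: the values at
  \<open>x\<close> lie in sets shrinking to \<open>y\<close>, and at every other point the sequence
  is eventually constant.\<close>

lemma limit_map_in_ellis: "limit_map \<in> ellis_semigroup G"
proof -
  have lim: "(\<lambda>n. g n z) \<longlonglongrightarrow> limit_map z" for z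
  proof (cases "z = x")
    case True
    show ?thesis
    proof (rule topological_tendstoI)
      fix S assume "open S" "limit_map z \<in> S"
      then obtain n where n: "g n ` U n \<subseteq> S" using True base_y limit_map_base by metis
      have "g m z \<in> S" if "m \<ge> n" for m
        using gU_antimono[OF that] n x_mem[of m] True by blast
      then show "\<forall>\<^sub>F n in sequentially. g n z \<in> S"
        unfolding eventually_sequentially by blast
    qed
  next
    case False
    then obtain n where n: "z \<notin> U n" using separate by blast
    then have "\<forall>\<^sub>F m in sequentially. g m z = limit_map z"
      unfolding eventually_sequentially using g_eq limit_map_eq by metis
    then show ?thesis by (rule tendsto_eventually)
  qed
  have "limitin (product_topology (\<lambda>i. euclidean) UNIV) g limit_map sequentially"
    using lim by (simp add: limitin_componentwise)
  then have "g \<longlonglongrightarrow> limit_map"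
    by (simp add: euclidean_product_topology)
  then show ?thesis
    unfolding ellis_semigroup_def
    by (rule Lim_in_closed_set[rotated 3])
      (auto intro!: always_eventually g_mem closure_subset[THEN subsetD])
qed

text \<open>The setting is symmetric in \<open>x\<close> and \<open>y\<close>, which provides the inverse of the limit map.\<close>

lemma inverse_sequence:
  "contracting_sequence G (\<lambda>n. inv (g n)) (\<lambda>n. g n ` U n) y x"
proof -
  have inv_image: "inv (g n) ` g n ` U n = U n" for n
    using bij_g by (simp add: bij_is_inj image_inv_f_f)
  have "inv (g (Suc n)) z = inv (g n) z" if z: "z \<notin> g n ` U n" for n z
  proof -
    obtain w where w: "z = g n w" using bij_g by (metis bij_pointE)
    then have "g (Suc n) w = z" using z g_Suc by auto
    then show ?thesis using w bij_g by (metis bij_is_inj inv_f_f)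
  qed
  then show ?thesis
    by unfold_locales
      (auto simp: inv_image x_mem y_mem U_Suc[THEN subsetD] intro: inv_mem g_mem
        open_image_mem open_U base_x base_y gU_Suc[THEN subsetD, OF imageI])
qed

interpretation inverse: contracting_sequence G "\<lambda>n. inv (g n)" "\<lambda>n. g n ` U n" y x
  by (rule inverse_sequence)

abbreviation limit_inverse :: "'a \<Rightarrow> 'a" where
  "limit_inverse \<equiv> inverse.limit_map"

text \<open>With \<open>limit_map_eq\<close>, this reduces both cancellation laws to a single stage
  \<open>n\<close>, once \<open>x\<close> and \<open>y\<close> are treated separately.\<close>

lemma limit_inverse_eq:
  assumes "z \<notin> U n"
  shows "limit_inverse (g n z) = z"
proof -
  have "g n z \<notin> g n ` U n" using assms by (simp add: g_mem_image_iff)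
  then have "limit_inverse (g n z) = inv (g n) (g n z)" by (rule inverse.limit_map_eq)
  then show ?thesis using bij_g by (simp add: bij_is_inj)
qed

lemma limit_inverse_limit: "limit_inverse (limit_map z) = z"
proof (cases "z = x")
  case True
  then show ?thesis by (simp add: limit_map_base inverse.limit_map_base)
next
  case False
  then obtain n where "z \<notin> U n" using separate by blast
  then show ?thesis by (simp add: limit_map_eq limit_inverse_eq)
qed

lemma limit_limit_inverse: "limit_map (limit_inverse z) = z"
proof (cases "z = y")
  case True
  then show ?thesis by (simp add: limit_map_base inverse.limit_map_base)
next
  case False
  obtain n N where "z \<in> N" "N \<inter> g n ` U n = {}" by (rule inverse.separate[OF False])
  then have n: "z \<notin> g n ` U n" by blast
  obtain w where w: "z = g n w" using bij_g by (metis bij_pointE)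
  with n have "w \<notin> U n" by blast
  then show ?thesis by (simp add: w limit_map_eq limit_inverse_eq)
qed

lemma homeomorphism_limit: "homeomorphism UNIV UNIV limit_map limit_inverse"
  using continuous_limit_map inverse.continuous_limit_map limit_inverse_limit limit_limit_inverse
  by (intro homeomorphismI) auto

section \<open>Conjugation of neighbourhood stabilisers\<close>

lemma conjugate_St0:
  assumes h: "h \<in> St0 G x"
  shows "limit_map \<circ> h \<circ> limit_inverse \<in> St0 G y"
proof -
  obtain W where hG: "h \<in> G" and W: "open W" "x \<in> W" "W \<subseteq> {z. h z = z}"
    using h by (auto simp: St0_def St_def)
  obtain n where "U n \<subseteq> W" using base_x[OF W(1,2)] by blast
  with W have n: "h z = z" if "z \<in> U n" for z using that by auto
  have g_inv: "g n (inv (g n) z) = z" for z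
    using bij_g by (simp add: bij_is_surj surj_f_inv_f)
  \<comment> \<open>As \<open>h\<close> is injective and fixes \<open>U n\<close> pointwise, no
    point enters \<open>U n\<close> from outside.\<close>
  have off: "h w \<notin> U n" if "w \<notin> U n" for w
    using that n bij_mem[OF hG] by (metis bij_pointE)
  \<comment> \<open>On the image of \<open>U n\<close> both sides are the identity. Off it,
    \<open>h\<close> is applied to a point off \<open>U n\<close> and yields another, so only values
    already settled at stage \<open>n\<close> occur.\<close>
  have "(limit_map \<circ> h \<circ> limit_inverse) z = (g n \<circ> h \<circ> inv (g n)) z" for z
  proof (cases "z \<in> g n ` U n")
    case True
    then have "inv (g n) z \<in> U n" using bij_g by (auto simp: bij_is_inj)
    moreover have "limit_inverse z \<in> U n"
      using inverse.limit_map_image[OF True] bij_g by (simp add: bij_is_inj image_inv_f_f)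
    ultimately show ?thesis by (simp add: n limit_limit_inverse g_inv)
  next
    case False
    then have "inv (g n) z \<notin> U n" by (metis g_inv imageI)
    then show ?thesis
      using inverse.limit_map_eq[OF False] by (simp add: off limit_map_eq)
  qed
  then have eq: "limit_map \<circ> h \<circ> limit_inverse = g n \<circ> h \<circ> inv (g n)" by blast
  have fixed: "(g n \<circ> h \<circ> inv (g n)) z = z" if "z \<in> g n ` U n" for z
    using that n bij_g by (auto simp: bij_is_inj)
  have conj: "g n \<circ> h \<circ> inv (g n) \<in> G"
    by (intro comp_mem g_mem hG inv_mem)
  have "g n ` U n \<subseteq> {z. (g n \<circ> h \<circ> inv (g n)) z = z}"
    using fixed by blast
  then show ?thesis
    unfolding eq St0_def St_def using conj fixed[OF y_mem] inverse.open_U[of n] y_mem[of n] by blast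
qed

end

text \<open>\<open>conjugate_St0\<close> gives one inclusion; the other follows from it for the
  inverse sequence.\<close>

lemma (in contracting_sequence) conjugating_homeomorphism:
  "\<exists>f f'. homeomorphism UNIV UNIV f f' \<and> f \<in> ellis_semigroup G \<and>
     (\<lambda>h. f \<circ> h \<circ> f') ` St0 G x = St0 G y"
proof -
  interpret inverse: contracting_sequence G "\<lambda>n. inv (g n)" "\<lambda>n. g n ` U n" y x
    by (rule inverse_sequence)
  \<comment> \<open>The limit of the twice inverted sequence is a left inverse of
    \<open>limit_inverse\<close>, and \<open>limit_map\<close> is a right inverse, so they
    coincide.\<close>
  have inverse_inverse_limit: "inverse.limit_inverse = limit_map"
    using inverse.limit_inverse_limit[of "limit_map z" for z] by (simp add: fun_eq_iff limit_inverse_limit)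
  have "k \<in> (\<lambda>h. limit_map \<circ> h \<circ> limit_inverse) ` St0 G x" if "k \<in> St0 G y" for k
  proof
    show "k = limit_map \<circ> (limit_inverse \<circ> k \<circ> limit_map) \<circ> limit_inverse"
      by (simp add: fun_eq_iff limit_limit_inverse)
    show "limit_inverse \<circ> k \<circ> limit_map \<in> St0 G x"
      using inverse.conjugate_St0[OF that] by (simp add: inverse_inverse_limit)
  qed
  then show ?thesis
    using homeomorphism_limit limit_map_in_ellis conjugate_St0 by blast
qed

section \<open>Construction of a contracting sequence\<close>

text \<open>The set \<open>W\<close> keeps \<open>y\<close> within reach: some point of
  \<open>W\<close> is mapped to \<open>y\<close>, and the orbit of \<open>x\<close> under
  \<open>Rist G U\<close> is dense in \<open>W\<close>. The next map is
  \<open>inv j \<circ> g \<circ> s\<close>, with \<open>s\<close> supported in \<open>U\<close> and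
  \<open>j\<close> near \<open>y\<close>.\<close>

lemma (in homeo_subgroup) contracting_step:
  assumes lmin: "\<And>U. open U \<Longrightarrow> locally_minimal_on (Rist G U) U"
    and g: "g \<in> G" and U: "open U"
    and W: "open W" "W \<subseteq> U" "x \<in> W" "W \<subseteq> closure (point_orbit (Rist G U) x \<inter> W)"
    and y: "y \<in> g ` W"
    and A: "open A" "x \<in> A" and B: "open B" "y \<in> B"
  obtains g' U' W' where "g' \<in> G" "open U'" "open W'" "W' \<subseteq> U'" "x \<in> W'"
    "W' \<subseteq> closure (point_orbit (Rist G U') x \<inter> W')" "y \<in> g' ` W'"
    "U' \<subseteq> U \<inter> A" "g' ` U' \<subseteq> g ` U \<inter> B" "\<And>z. z \<notin> U \<Longrightarrow> g' z = g z"
proof -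
  have loc: "\<exists>W. open W \<and> W \<subseteq> U \<and> z \<in> W \<and>
      (\<forall>v\<in>W. W \<subseteq> closure (point_orbit (Rist G U) v \<inter> W))" if "open U" "z \<in> U" for U z
    using lmin[OF that(1)] that openin_open_eq[OF that(1)] unfolding locally_minimal_on_def by metis
  have bg: "bij g" using g by (rule bij_mem)
  \<comment> \<open>Lying in the image of \<open>U\<close>, the set \<open>C\<close> contains no
    \<open>g z\<close> with \<open>z\<close> off \<open>U\<close>, so an element of
    \<open>Rist G C\<close> does not disturb these values. Lying in \<open>B\<close>, it makes the
    new image small.\<close>
  define C where "C = g ` U \<inter> B"
  have C: "open C" "y \<in> C"
    using y W B open_image_mem[OF g U] by (auto simp: C_def)
  then obtain V where V: "open V" "V \<subseteq> C" "y \<in> V"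
      and V_min: "\<And>v. v \<in> V \<Longrightarrow> V \<subseteq> closure (point_orbit (Rist G C) v \<inter> V)"
    using loc[OF C] by blast
  obtain p where p: "p \<in> W" "y = g p" using y by blast
  have "open (g -` V)" "p \<in> g -` V"
    using open_vimage_mem[OF g] V p by auto
  moreover have "p \<in> closure (point_orbit (Rist G U) x \<inter> W)" using p W by blast
  ultimately obtain q where "q \<in> g -` V" "q \<in> point_orbit (Rist G U) x"
    by (meson IntD1 closure_iff_nhds_not_empty disjoint_iff order_refl)
  then obtain s where s: "s \<in> Rist G U" "g (s x) \<in> V" by (auto simp: point_orbit_def)
  have sG: "s \<in> G" and gsG: "g \<circ> s \<in> G"
    using s g comp_mem by (auto simp: Rist_def)
  \<comment> \<open>The last factor forces the image of \<open>U'\<close> into \<open>C\<close>;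
    local minimality is then applied to this new set to get \<open>W'\<close>.\<close>
  define U' where "U' = U \<inter> A \<inter> (g \<circ> s) -` C"
  have "open U'" "x \<in> U'"
    using open_vimage_mem[OF gsG] U A W C V s by (auto simp: U'_def)
  from loc[OF this] obtain W' where W': "open W'" "W' \<subseteq> U'" "x \<in> W'"
      "W' \<subseteq> closure (point_orbit (Rist G U') x \<inter> W')"
    by blast
  have "open ((g \<circ> s) ` W')" "g (s x) \<in> (g \<circ> s) ` W'"
    using open_image_mem[OF gsG] W' by auto
  \<comment> \<open>Both \<open>y\<close> and \<open>g (s x)\<close> lie in \<open>V\<close>, so the
    orbit of \<open>y\<close> enters the image of \<open>W'\<close>, a neighbourhood of
    \<open>g (s x)\<close>.\<close>
  moreover have "g (s x) \<in> closure (point_orbit (Rist G C) y \<inter> V)"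
    using V_min[OF V(3)] s by blast
  ultimately obtain q' where q': "q' \<in> (g \<circ> s) ` W'" "q' \<in> point_orbit (Rist G C) y"
    by (meson IntD1 closure_iff_nhds_not_empty disjoint_iff order_refl)
  from q'(2) obtain j where "j \<in> Rist G C" "q' = j y" by (auto simp: point_orbit_def)
  with q'(1) have j: "j \<in> Rist G C" "j y \<in> (g \<circ> s) ` W'" by simp_all
  have jG: "j \<in> G" using j by (simp add: Rist_def)
  \<comment> \<open>Since \<open>k\<close> maps \<open>C\<close> onto itself, applying it after \<open>g \<circ> s\<close> keeps the image of \<open>U'\<close> in \<open>C\<close>.\<close>
  define k where "k = inv j"
  have k: "k \<in> Rist G C" using inv_Rist[OF j(1)] by (simp add: k_def)
  have kj: "k (j y) = y" using bij_mem[OF jG] by (simp add: k_def bij_is_inj)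
  show ?thesis
  proof (rule that)
    show "k \<circ> (g \<circ> s) \<in> G"
      using k gsG comp_mem by (auto simp: Rist_def)
    show "y \<in> (k \<circ> (g \<circ> s)) ` W'"
      using imageI[OF j(2), of k] kj by (simp add: image_comp)
    have "(g \<circ> s) ` U' \<subseteq> C" by (auto simp: U'_def)
    then have "(k \<circ> (g \<circ> s)) ` U' \<subseteq> C"
      using Rist_image[OF k] by (metis image_comp image_mono)
    then show "(k \<circ> (g \<circ> s)) ` U' \<subseteq> g ` U \<inter> B" by (simp add: C_def)
    show "(k \<circ> (g \<circ> s)) z = g z" if z: "z \<notin> U" for z
    proof -
      have "s z = z" using s z by (simp add: Rist_def)
      moreover have "g z \<notin> C" using z bg by (auto simp: C_def bij_is_inj inj_image_mem_iff)
      ultimately show ?thesis using k by (simp add: Rist_def)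
    qed
  qed (use W' \<open>open U'\<close> in \<open>auto simp: U'_def\<close>)
qed

lemma contracting_sequence_exists:
  fixes G :: "('a::{first_countable_topology, t2_space} \<Rightarrow> 'a) set"
  assumes "subgroup G homeo_group" and "minimal_action G"
    and lmin: "\<And>U. open U \<Longrightarrow> locally_minimal_on (Rist G U) U"
  shows "\<exists>g U. contracting_sequence G g U x y"
proof -
  interpret homeo_subgroup G using assms(1) by (rule homeo_subgroup.intro)
  obtain A :: "nat \<Rightarrow> 'a set" where A: "\<And>i. open (A i)" "\<And>i. x \<in> A i"
      "\<And>S. open S \<Longrightarrow> x \<in> S \<Longrightarrow> eventually (\<lambda>i. A i \<subseteq> S) sequentially"
    using countable_basis_at_decseq[of x] by metis
  obtain B :: "nat \<Rightarrow> 'a set" where B: "\<And>i. open (B i)" "\<And>i. y \<in> B i"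
      "\<And>S. open S \<Longrightarrow> y \<in> S \<Longrightarrow> eventually (\<lambda>i. B i \<subseteq> S) sequentially"
    using countable_basis_at_decseq[of y] by metis
  \<comment> \<open>Dependent choice runs over triples: \<open>P\<close> is the invariant of one
    stage, \<open>Q n\<close> the relation between consecutive stages.\<close>
  define P where "P = (\<lambda>(g, U, W). g \<in> G \<and> open U \<and> open W \<and> W \<subseteq> U \<and> x \<in> W \<and>
    W \<subseteq> closure (point_orbit (Rist G U) x \<inter> W) \<and> y \<in> g ` W)"
  define Q where "Q n = (\<lambda>(g, U, W :: 'a set) (g', U', W' :: 'a set).
    U' \<subseteq> U \<inter> A n \<and> g' ` U' \<subseteq> g ` U \<inter> B n \<and> (\<forall>z. z \<notin> U \<longrightarrow> g' z = g z))" for n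
  have "\<exists>t. P t"
  proof -
    have "locally_minimal_on (Rist G UNIV) UNIV" by (rule lmin) simp
    then have "\<exists>W. open W \<and> x \<in> W \<and> (\<forall>y\<in>W. W \<subseteq> closure (point_orbit (Rist G UNIV) y \<inter> W))"
      unfolding locally_minimal_on_def by simp
    then obtain W where W: "open W" "x \<in> W" "W \<subseteq> closure (point_orbit (Rist G UNIV) x \<inter> W)"
      by auto
    \<comment> \<open>By minimality some \<open>h\<close> in \<open>G\<close> moves \<open>y\<close>
      into \<open>W\<close>; its inverse is the first map.\<close>
    have "y \<in> closure (point_orbit G y)" "x \<in> closure (point_orbit G y)"
      using assms(2) by (simp_all add: minimal_action_def)
    then obtain q where "q \<in> W" "q \<in> point_orbit G y"
      using W by (meson closure_iff_nhds_not_empty disjoint_iff order_refl)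
    then obtain h where h: "h \<in> G" "h y \<in> W" by (auto simp: point_orbit_def)
    have "y = inv h (h y)" using bij_mem[OF h(1)] by (simp add: bij_is_inj)
    then have "y \<in> inv h ` W" using h(2) by blast
    then have "P (inv h, UNIV, W)" using W inv_mem[OF h(1)] by (simp add: P_def)
    then show ?thesis ..
  qed
  moreover have "\<exists>t'. P t' \<and> Q n t t'" if "P t" for t n
  proof -
    obtain g U W where t: "t = (g, U, W)" by (cases t)
    have invariant: "g \<in> G" "open U" "open W" "W \<subseteq> U" "x \<in> W"
        "W \<subseteq> closure (point_orbit (Rist G U) x \<inter> W)" "y \<in> g ` W"
      using that by (simp_all add: P_def t)
    show ?thesis
    proof (rule contracting_step[OF lmin invariant A(1,2)[of n] B(1,2)[of n]])
      fix g' U' W'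
      assume "g' \<in> G" "open U'" "open W'" "W' \<subseteq> U'" "x \<in> W'"
        "W' \<subseteq> closure (point_orbit (Rist G U') x \<inter> W')" "y \<in> g' ` W'"
        "U' \<subseteq> U \<inter> A n" "g' ` U' \<subseteq> g ` U \<inter> B n" "\<And>z. z \<notin> U \<Longrightarrow> g' z = g z"
      then have "P (g', U', W') \<and> Q n t (g', U', W')"
        unfolding P_def Q_def t by simp
      then show ?thesis ..
    qed
  qed
  ultimately obtain F where F: "\<And>n. P (F n)" "\<And>n. Q n (F n) (F (Suc n))"
    using dependent_nat_choice[of "\<lambda>_. P" Q] by blast
  define g where "g n = fst (F n)" for n
  define U where "U n = fst (snd (F n))" for n
  \<comment> \<open>Since \<open>A n\<close> and \<open>B n\<close> bound stage
    \<open>Suc n\<close>, the base conditions below are witnessed by \<open>Suc n\<close>.\<close>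
  have step: "U (Suc n) \<subseteq> U n \<inter> A n" "g (Suc n) ` U (Suc n) \<subseteq> g n ` U n \<inter> B n"
      "\<And>z. z \<notin> U n \<Longrightarrow> g (Suc n) z = g n z" for n
    using F(2)[of n] by (auto simp: Q_def g_def U_def split_beta)
  have "contracting_sequence G g U x y"
  proof
    fix n
    show "g n \<in> G" "open (U n)" "x \<in> U n" "y \<in> g n ` U n"
      using F(1)[of n] by (auto simp: P_def g_def U_def split_beta)
  next
    fix S assume "open S" "x \<in> S"
    from A(3)[OF this] obtain n where "A n \<subseteq> S" by (auto simp: eventually_sequentially)
    then show "\<exists>n. U n \<subseteq> S" using step(1)[of n] by blast
  next
    fix S assume "open S" "y \<in> S"
    from B(3)[OF this] obtain n where "B n \<subseteq> S" by (auto simp: eventually_sequentially)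
    then show "\<exists>n. g n ` U n \<subseteq> S" using step(2)[of n] by blast
  qed (use step in auto)
  then show ?thesis by blast
qed

section \<open>Conjugacy and isomorphism of the stabilisers\<close>

theorem theorem1:
  fixes G :: "('a::{first_countable_topology, t2_space} \<Rightarrow> 'a) set"
    and x y :: 'a
  assumes "subgroup G homeo_group"
    and "minimal_action G"
    and "\<And>U. open U \<Longrightarrow> locally_minimal_on (Rist G U) U"
  shows "(\<exists>f f'. homeomorphism UNIV UNIV f f' \<and> f \<in> ellis_semigroup G \<and>
            (\<lambda>h. f \<circ> h \<circ> f') ` St0 G x = St0 G y) \<and>
         homeo_group\<lparr>carrier := St0 G x\<rparr> \<cong> homeo_group\<lparr>carrier := St0 G y\<rparr>"
proof -
  obtain g U where "contracting_sequence G g U x y"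
    using contracting_sequence_exists[OF assms] by blast
  then have ex: "\<exists>f f'. homeomorphism UNIV UNIV f f' \<and> f \<in> ellis_semigroup G \<and>
      (\<lambda>h. f \<circ> h \<circ> f') ` St0 G x = St0 G y"
    by (rule contracting_sequence.conjugating_homeomorphism)
  then obtain f f' where ff': "homeomorphism UNIV UNIV f f'"
      and img: "(\<lambda>h. f \<circ> h \<circ> f') ` St0 G x = St0 G y"
    by blast
  have cancel: "f' (f z) = z" "f (f' z) = z" for z
    using ff' by (simp_all add: homeomorphism_def)
  have "inj_on (\<lambda>h. f \<circ> h \<circ> f') (St0 G x)"
  proof (rule inj_on_inverseI)
    show "f' \<circ> (f \<circ> h \<circ> f') \<circ> f = h" for h
      by (simp add: fun_eq_iff cancel)
  qed
  \<comment> \<open>Multiplicativity holds because \<open>f'\<close> and \<open>f\<close> cancel in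
    the middle of a product of conjugates.\<close>
  then have "(\<lambda>h. f \<circ> h \<circ> f') \<in>
      iso (homeo_group\<lparr>carrier := St0 G x\<rparr>) (homeo_group\<lparr>carrier := St0 G y\<rparr>)"
    using img by (auto simp: iso_def hom_def bij_betw_def homeo_group_def fun_eq_iff cancel)
  with ex show ?thesis by (blast intro: is_isoI)
qed

end
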